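(* Let $(X,\rho,\mu)$ be a $K$-doubling metric measure space, $(M,d)$ a complete metric space, $Q\ge1$ an integer, and $\mathcal D$ a differentiably complete approximate $X$-distribution for $M$. Then the approximate $X$-distribution $\mathcal D^Q$ for $\mathcal A_Q(M)$ is differentiably complete.
   Context: A $K$-doubling metric measure space ($K>0$) is a triple $(X,\rho,\mu)$ where $(X,\rho)$ is a complete separable metric space and $\mu$ is a Borel-regular outer measure with $0<\mu(B_{2r}(x))\le K\mu(B_r(x))<+\infty$ for all $x,r>0$. A set $E\ni x$ is a $\mu$-neighborhood of $x$ if there is a Borel $B\subseteq E$ with $\lim_{r\to0^+}\mu(B_r(x)\setminus B)/\mu(B_r(x))=0$; $x$ is a $\mu$-accumulation point of $A$ if $A\cap U\setminus\{x\}\neq\emptyset$ for all $\mu$-neighborhoods $U$ of $x$; $\mu\text{-}\lim$, $\mu\text{-}\limsup$ denote limit and upper limit along $\mu$-neighborhoods (e.g. $\mu\text{-}\limsup_{y\in A,y\to x}g(y)=\inf_U\sup_{y\in U\cap A\setminus\{x\}}g(y)$). $\mathcal A_Q(M)$ is the set of measures $\sum_{i=1}^Q[\![P_i]\!]$ (Dirac masses at not necessarily distinct $P_i\in M$) with metric $\mathcal G(\sum_i[\![A_i]\!],\sum_i[\![B_i]\!])=\min_\sigma\sqrt{\sum_i d(A_i,B_{\sigma(i)})^2}$ over permutations $\sigma$; it is a complete metric space. For a complete metric space $(N,e)$, $x\in X$, $P\in N$, $\mathcal C^\mu_{x,P}(N)$ is the set of classes $[F]$ of Lipschitz maps $F\colon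 B\to N$ on a $\mu$-neighborhood $B$ of $x$ with $F(x)=P$, modulo $F\sim G\iff\mu\text{-}\lim_{y\to x}e(F(y),G(y))/\rho(y,x)=0$; an approximate $X$-distribution for $N$ is any subset $\mathcal E$ of $\bigsqcup_{(x,P)}\mathcal C^\mu_{x,P}(N)$, and $\mathcal E_{x,P}=\mathcal E\cap\mathcal C^\mu_{x,P}(N)$. For $f\colon A\to N$ and a $\mu$-accumulation point $x\in A$ of $A$, $f$ is approximately $\mathcal E$-differentiable at $x$ if some $[F]\in\mathcal E_{x,f(x)}$ satisfies $\mu\text{-}\lim_{y\in A,y\to x}e(f(y),F(y))/\rho(y,x)=0$. $A_f^\mu$ is the set of $\mu$-accumulation points $x\in A$ of $A$ with $\mu\text{-}\limsup_{y\in A,y\to x}e(f(y),f(x))/\rho(y,x)<\infty$. $\mathcal E$ is differentiably complete if for every nonempty closed $C\subseteq X$ and every Lipschitz $g\colon C\to N$ and every $\mu$-measurable $B\subseteq A_g^\mu$, $g$ is approximately $\mathcal E$-differentiable at $\mu$-a.e. point of $B$. Finally, $\mathcal D^Q$ is defined by: for $\mathbf P=\sum_{i=1}^Q[\![P_i]\!]\in\mathcal A_Q(M)$, $[\mathbf F]\in\mathcal D^Q_{x_0,\mathbf P}$ iff there exist $[F_i]\in\mathcal D_{x_0,P_i}$, $i=1,\dots,Q$, such that $\mathbf F(x)=\sum_{i=1}^Q[\![F_i(x)]\!]$ for all $x$ in a Borel $\mu$-neighborhood of $x_0$, and $P_i=P_j$ implies $[F_i]=[F_j]$. *)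

theory Defs
  imports "HOL-Analysis.Analysis" "HOL-Probability.Probability" "HOL-Library.Multiset"
begin

text \<open>The metric measure space X is a type of class polish_space (complete, separable metric
space). The Borel-regular outer measure is represented by a measure on the Borel sets;
mu-measurable sets are the sets of its completion, and mu-a.e. means outside a mu-null set.\<close>

definition doubling_mms :: "real \<Rightarrow> 'a::polish_space measure \<Rightarrow> bool" where
  "doubling_mms K mu \<longleftrightarrow> K > 0 \<and> sets mu = sets borel \<and>
     (\<forall>x r. r > 0 \<longrightarrow> 0 < emeasure mu (ball x r) \<and>
        emeasure mu (ball x (2*r)) \<le> ennreal K * emeasure mu (ball x r) \<and>
        emeasure mu (ball x r) < \<infinity>)"

definition mu_nbhd :: "'a::metric_space measure \<Rightarrow> 'a \<Rightarrow> 'a set \<Rightarrow> bool" where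
  "mu_nbhd mu x E \<longleftrightarrow> x \<in> E \<and> (\<exists>B. B \<in> sets borel \<and> B \<subseteq> E \<and>
     ((\<lambda>r. measure mu (ball x r - B) / measure mu (ball x r)) \<longlongrightarrow> 0) (at_right 0))"

definition mu_acc :: "'a::metric_space measure \<Rightarrow> 'a set \<Rightarrow> 'a \<Rightarrow> bool" where
  "mu_acc mu A x \<longleftrightarrow> (\<forall>U. mu_nbhd mu x U \<longrightarrow> A \<inter> U - {x} \<noteq> {})"

definition mu_lim :: "'a::metric_space measure \<Rightarrow> 'a set \<Rightarrow> ('a \<Rightarrow> real) \<Rightarrow> 'a \<Rightarrow> real \<Rightarrow> bool" where
  "mu_lim mu A g x L \<longleftrightarrow>
     (\<forall>\<epsilon>>0. \<exists>U. mu_nbhd mu x U \<and> (\<forall>y \<in> U \<inter> A - {x}. \<bar>g y - L\<bar> < \<epsilon>))"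

definition mu_limsup :: "'a::metric_space measure \<Rightarrow> 'a set \<Rightarrow> ('a \<Rightarrow> real) \<Rightarrow> 'a \<Rightarrow> ereal" where
  "mu_limsup mu A g x = (INF U \<in> {U. mu_nbhd mu x U}. SUP y \<in> U \<inter> A - {x}. ereal (g y))"

definition lipschitz_into :: "'n set \<Rightarrow> ('n \<Rightarrow> 'n \<Rightarrow> real) \<Rightarrow> 'a::metric_space set \<Rightarrow> ('a \<Rightarrow> 'n) \<Rightarrow> bool" where
  "lipschitz_into N e A f \<longleftrightarrow> f ` A \<subseteq> N \<and>
     (\<exists>L. \<forall>y\<in>A. \<forall>z\<in>A. e (f y) (f z) \<le> L * dist y z)"

definition germ_rep :: "'a::metric_space measure \<Rightarrow> 'n set \<Rightarrow> ('n \<Rightarrow> 'n \<Rightarrow> real) \<Rightarrow> 'a \<Rightarrow> 'n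
    \<Rightarrow> 'a set \<Rightarrow> ('a \<Rightarrow> 'n) \<Rightarrow> bool" where
  "germ_rep mu N e x P B F \<longleftrightarrow> mu_nbhd mu x B \<and> lipschitz_into N e B F \<and> F x = P"

definition germ_class :: "'a::metric_space measure \<Rightarrow> 'n set \<Rightarrow> ('n \<Rightarrow> 'n \<Rightarrow> real) \<Rightarrow> 'a \<Rightarrow> 'n
    \<Rightarrow> 'a set \<Rightarrow> ('a \<Rightarrow> 'n) \<Rightarrow> ('a set \<times> ('a \<Rightarrow> 'n)) set" where
  "germ_class mu N e x P B F = {(B', G). germ_rep mu N e x P B' G \<and>
      mu_lim mu (B \<inter> B') (\<lambda>y. e (F y) (G y) / dist y x) x 0}"

definition germ_classes :: "'a::metric_space measure \<Rightarrow> 'n set \<Rightarrow> ('n \<Rightarrow> 'n \<Rightarrow> real) \<Rightarrow> 'a \<Rightarrow> 'n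
    \<Rightarrow> ('a set \<times> ('a \<Rightarrow> 'n)) set set" where
  "germ_classes mu N e x P = {germ_class mu N e x P B F | B F. germ_rep mu N e x P B F}"

text \<open>An approximate X-distribution for N: a set of triples (x, P, c) with c in C^mu_{x,P}(N)
  (this encodes the disjoint union); E_{x,P} = {c. (x,P,c) \<in> E}.\<close>
definition approx_distribution :: "'a::metric_space measure \<Rightarrow> 'n set \<Rightarrow> ('n \<Rightarrow> 'n \<Rightarrow> real)
    \<Rightarrow> ('a \<times> 'n \<times> ('a set \<times> ('a \<Rightarrow> 'n)) set) set \<Rightarrow> bool" where
  "approx_distribution mu N e E \<longleftrightarrow>
     E \<subseteq> {(x, P, c). x \<in> UNIV \<and> P \<in> N \<and> c \<in> germ_classes mu N e x P}"

definition approx_diff :: "'a::metric_space measure \<Rightarrow> ('n \<Rightarrow> 'n \<Rightarrow> real)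
    \<Rightarrow> ('a \<times> 'n \<times> ('a set \<times> ('a \<Rightarrow> 'n)) set) set \<Rightarrow> 'a set \<Rightarrow> ('a \<Rightarrow> 'n) \<Rightarrow> 'a \<Rightarrow> bool" where
  "approx_diff mu e E A f x \<longleftrightarrow> x \<in> A \<and> mu_acc mu A x \<and>
     (\<exists>c. (x, f x, c) \<in> E \<and> (\<exists>(B, F) \<in> c.
        mu_lim mu (A \<inter> B) (\<lambda>y. e (f y) (F y) / dist y x) x 0))"

definition acc_bounded_set :: "'a::metric_space measure \<Rightarrow> ('n \<Rightarrow> 'n \<Rightarrow> real) \<Rightarrow> 'a set
    \<Rightarrow> ('a \<Rightarrow> 'n) \<Rightarrow> 'a set" where
  "acc_bounded_set mu e A f = {x \<in> A. mu_acc mu A x \<and>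
      mu_limsup mu A (\<lambda>y. e (f y) (f x) / dist y x) x < \<infinity>}"

definition diff_complete :: "'a::metric_space measure \<Rightarrow> 'n set \<Rightarrow> ('n \<Rightarrow> 'n \<Rightarrow> real)
    \<Rightarrow> ('a \<times> 'n \<times> ('a set \<times> ('a \<Rightarrow> 'n)) set) set \<Rightarrow> bool" where
  "diff_complete mu N e E \<longleftrightarrow>
     (\<forall>C g B. closed C \<and> C \<noteq> {} \<and> lipschitz_into N e C g \<and>
        B \<in> sets (completion mu) \<and> B \<subseteq> acc_bounded_set mu e C g \<longrightarrow>
        (AE x in completion mu. x \<in> B \<longrightarrow> approx_diff mu e E C g x))"

text \<open>A_Q(M): multisets of size Q with support in M, with the distance G
  (minimum over matchings = permutations).\<close>
definition AQ :: "'m set \<Rightarrow> nat \<Rightarrow> 'm multiset set" where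
  "AQ M Q = {S. size S = Q \<and> set_mset S \<subseteq> M}"

definition AQ_dist :: "('m \<Rightarrow> 'm \<Rightarrow> real) \<Rightarrow> 'm multiset \<Rightarrow> 'm multiset \<Rightarrow> real" where
  "AQ_dist d S T = Inf {sqrt (\<Sum>p\<in>#Z. (d (fst p) (snd p))\<^sup>2) | Z.
      image_mset fst Z = S \<and> image_mset snd Z = T}"

definition DQ :: "'a::metric_space measure \<Rightarrow> 'm set \<Rightarrow> ('m \<Rightarrow> 'm \<Rightarrow> real) \<Rightarrow> nat
    \<Rightarrow> ('a \<times> 'm \<times> ('a set \<times> ('a \<Rightarrow> 'm)) set) set
    \<Rightarrow> ('a \<times> 'm multiset \<times> ('a set \<times> ('a \<Rightarrow> 'm multiset)) set) set" where
  "DQ mu M d Q D = {(x0, PP, c). PP \<in> AQ M Q \<and> c \<in> germ_classes mu (AQ M Q) (AQ_dist d) x0 PP \<and>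
     (\<exists>Ps :: nat \<Rightarrow> 'm. \<exists>cs. mset (map Ps [0..<Q]) = PP \<and>
        (\<forall>i<Q. (x0, Ps i, cs i) \<in> D) \<and>
        (\<forall>i<Q. \<forall>j<Q. Ps i = Ps j \<longrightarrow> cs i = cs j) \<and>
        (\<exists>(B, FF) \<in> c. \<exists>Bs Fs. (\<forall>i<Q. (Bs i, Fs i) \<in> cs i) \<and>
           (\<exists>U. U \<in> sets borel \<and> mu_nbhd mu x0 U \<and> U \<subseteq> B \<and> (\<forall>i<Q. U \<subseteq> Bs i) \<and>
              (\<forall>x\<in>U. FF x = mset (map (\<lambda>i. Fs i x) [0..<Q])))))}"

end

theory Submission
  imports Defs
begin

text \<open>Let \<open>S\<^sub>n\<close> be the set of \<open>y \<in> C\<close> for which distinct points of \<open>g y\<close> are at least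
  \<open>1 / (n + 1)\<close> apart. The sets \<open>S\<^sub>n\<close> are closed and exhaust \<open>C\<close>, and on a piece \<open>A\<close> of \<open>S\<^sub>n\<close> of small
  diameter \<open>g\<close> splits into Lipschitz branches \<open>f\<^sub>p\<close>, one for each point \<open>p\<close> of a single value
  \<open>g x0\<close>, counted with multiplicity; distinct branches never meet, so no induction on \<open>Q\<close> is needed.
  By the Lebesgue density theorem \<open>A\<close> is a \<open>\<mu>\<close>-neighbourhood of almost every one of its points.
  There differentiability of the branches on \<open>A\<close> yields that of \<open>g\<close> on all of \<open>C\<close>.\<close>

section \<open>Lebesgue density in doubling spaces\<close>

text \<open>Greedy selection: keep a ball of largest radius, discard every ball meeting it, and
  recurse on the rest. A discarded ball meets the kept one and has no larger radius, so tripling the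
  kept radius swallows it.\<close>

lemma finite_ball_vitali:
  fixes I :: "('a::metric_space \<times> real) set"
  assumes "finite I" "\<And>c r. (c, r) \<in> I \<Longrightarrow> 0 < r"
  shows "\<exists>J\<subseteq>I. disjoint_family_on (\<lambda>(c, r). ball c r) J \<and>
           (\<Union>(c, r)\<in>I. ball c r) \<subseteq> (\<Union>(c, r)\<in>J. ball c (3 * r))"
  using assms
proof (induction I rule: finite_psubset_induct)
  case (psubset I)
  show ?case
  proof (cases "I = {}")
    case True
    then show ?thesis by (auto simp: disjoint_family_on_def)
  next
    case False
    obtain p where p: "p \<in> I" "\<And>q. q \<in> I \<Longrightarrow> snd q \<le> snd p"
    proof -
      have "Max (snd ` I) \<in> snd ` I" using psubset.hyps False by (intro Max_in) auto
      then obtain p where "p \<in> I" "snd p = Max (snd ` I)" by auto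
      then show ?thesis using psubset.hyps that by auto
    qed
    obtain a s where as: "p = (a, s)" by force
    have s: "0 < s" using psubset.prems p as by auto
    define I' where "I' = {(c, r) \<in> I. ball c r \<inter> ball a s = {}}"
    \<comment> \<open>Since \<open>s\<close> is positive, \<open>ball a s\<close> meets itself;
      hence \<open>p\<close> drops out and the induction applies to a proper subset.\<close>
    have "p \<notin> I'" using s unfolding I'_def as by auto
    moreover have "I' \<subseteq> I" unfolding I'_def by auto
    ultimately have "I' \<subset> I" using p(1) by blast
    from psubset.IH[OF this] psubset.prems obtain J where J: "J \<subseteq> I'"
      "disjoint_family_on (\<lambda>(c, r). ball c r) J"
      "(\<Union>(c, r)\<in>I'. ball c r) \<subseteq> (\<Union>(c, r)\<in>J. ball c (3 * r))"
      unfolding I'_def by fastforce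
    have "ball c r \<subseteq> ball a (3 * s)" if cr: "(c, r) \<in> I" "(c, r) \<notin> I'" for c r
    proof
      fix y assume y: "y \<in> ball c r"
      obtain z where z: "dist c z < r" "dist a z < s" using cr unfolding I'_def by auto
      have "r \<le> s" using p(2)[OF cr(1)] as by simp
      moreover have "dist a y \<le> dist a z + dist c z + dist c y"
        by (metis add.commute add_left_mono dist_commute dist_triangle dist_triangle2 order_trans)
      ultimately show "y \<in> ball a (3 * s)" using y z by auto
    qed
    then have "(\<Union>(c, r)\<in>I. ball c r) \<subseteq> (\<Union>(c, r)\<in>insert p J. ball c (3 * r))"
      using J(3) unfolding as by fastforce
    moreover have "disjoint_family_on (\<lambda>(c, r). ball c r) (insert p J)"
      using J(1,2) unfolding disjoint_family_on_def I'_def as by fastforce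
    moreover have "insert p J \<subseteq> I" using J(1) p(1) unfolding I'_def by auto
    ultimately show ?thesis by blast
  qed
qed

context
  fixes K :: real and mu :: "'a::polish_space measure"
  assumes doubling: "doubling_mms K mu"
begin

lemma sets_mu [simp, measurable_cong]: "sets mu = sets borel"
  using doubling unfolding doubling_mms_def by simp

lemma space_mu [simp]: "space mu = UNIV"
  using sets_eq_imp_space_eq[OF sets_mu] by simp

lemma emeasure_ball_finite: "emeasure mu (ball x r) < \<infinity>"
proof (cases "0 < r")
  case True
  then show ?thesis using doubling unfolding doubling_mms_def by simp
qed (simp add: ball_empty)

lemma fmeasurable_ball_Diff:
  assumes "B \<in> sets borel" shows "ball x r - B \<in> fmeasurable mu"
proof (rule fmeasurableI2)
  show "ball x r \<in> fmeasurable mu" using emeasure_ball_finite by (intro fmeasurableI) simp_all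
qed (use assms in auto)

lemma measure_ball_pos:
  assumes "0 < r" shows "0 < measure mu (ball x r)"
proof -
  have "0 < emeasure mu (ball x r)" using assms doubling unfolding doubling_mms_def by simp
  then show ?thesis
    using emeasure_ball_finite[of x r] by (simp add: measure_def enn2real_positive_iff)
qed

text \<open>Doubling twice reaches radius \<open>4 * r\<close>, which covers the enlargement in the
  Vitali lemma; this is the source of the constant \<open>K\<^sup>2\<close>.\<close>

lemma emeasure_ball_triple:
  assumes "0 < r" shows "emeasure mu (ball x (3 * r)) \<le> ennreal (K\<^sup>2) * emeasure mu (ball x r)"
proof -
  have dbl: "emeasure mu (ball x (2 * s)) \<le> ennreal K * emeasure mu (ball x s)" if "0 < s" for s
    using doubling that unfolding doubling_mms_def by auto
  have K: "0 < K" using doubling unfolding doubling_mms_def by simp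
  have "emeasure mu (ball x (3 * r)) \<le> emeasure mu (ball x (2 * (2 * r)))"
    using assms by (intro emeasure_mono) auto
  also have "\<dots> \<le> ennreal K * emeasure mu (ball x (2 * r))" using assms by (intro dbl) auto
  also have "\<dots> \<le> ennreal K * (ennreal K * emeasure mu (ball x r))"
    using assms by (intro mult_left_mono dbl) auto
  also have "\<dots> = ennreal (K\<^sup>2) * emeasure mu (ball x r)"
    using K by (simp add: power2_eq_square ennreal_mult mult.assoc)
  finally show ?thesis .
qed

text \<open>Passing to disjoint Vitali balls costs the factor \<open>K\<^sup>2\<close>. Each
  selected ball has mass at most \<open>s\<close> times that of its part outside \<open>A\<close>,
  and these parts are disjoint subsets of \<open>W - A\<close>, so their masses add up to at most
  that of \<open>W - A\<close>.\<close>

lemma emeasure_finite_UN_ball_le: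
  assumes I: "finite I" "\<And>c r. (c, r) \<in> I \<Longrightarrow> 0 < r \<and> ball c r \<subseteq> W \<and>
      emeasure mu (ball c r) \<le> s * emeasure mu (ball c r - A)"
    and A: "A \<in> sets borel" and W: "W \<in> sets borel"
  shows "emeasure mu (\<Union>(c, r)\<in>I. ball c r) \<le> ennreal (K\<^sup>2) * s * emeasure mu (W - A)"
proof -
  obtain J where J: "J \<subseteq> I" "disjoint_family_on (\<lambda>(c, r). ball c r) J"
    "(\<Union>(c, r)\<in>I. ball c r) \<subseteq> (\<Union>(c, r)\<in>J. ball c (3 * r))"
    using finite_ball_vitali[OF I(1)] I(2) by blast
  have fJ: "finite J" using J(1) I(1) finite_subset by blast
  have "emeasure mu (\<Union>(c, r)\<in>I. ball c r) \<le> emeasure mu (\<Union>(c, r)\<in>J. ball c (3 * r))"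
    using J(3) by (intro emeasure_mono) (auto simp: split_beta intro!: borel_open)
  also have "\<dots> \<le> (\<Sum>p\<in>J. emeasure mu (case p of (c, r) \<Rightarrow> ball c (3 * r)))"
    using fJ by (intro emeasure_subadditive_finite) auto
  also have "\<dots> \<le> (\<Sum>p\<in>J. ennreal (K\<^sup>2) * s * emeasure mu ((case p of (c, r) \<Rightarrow> ball c r) - A))"
  proof (rule sum_mono, clarify)
    fix c r assume "(c, r) \<in> J"
    then have cr: "0 < r" "emeasure mu (ball c r) \<le> s * emeasure mu (ball c r - A)"
      using I(2) J(1) by auto
    show "emeasure mu (ball c (3 * r)) \<le> ennreal (K\<^sup>2) * s * emeasure mu (ball c r - A)"
      using order_trans[OF emeasure_ball_triple[OF cr(1), of c] mult_left_mono[OF cr(2)]]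
      by (simp add: mult.assoc)
  qed
  also have "\<dots> = ennreal (K\<^sup>2) * s * emeasure mu (\<Union>p\<in>J. (case p of (c, r) \<Rightarrow> ball c r) - A)"
    unfolding sum_distrib_left[symmetric]
  proof (subst sum_emeasure)
    show "disjoint_family_on (\<lambda>p. (case p of (c, r) \<Rightarrow> ball c r) - A) J"
      using J(2) unfolding disjoint_family_on_def by blast
  qed (use fJ A in auto)
  also have "\<dots> \<le> ennreal (K\<^sup>2) * s * emeasure mu (W - A)"
  proof (intro mult_left_mono emeasure_mono)
    have "ball c r \<subseteq> W" if "(c, r) \<in> J" for c r using I(2) J(1) that by blast
    then show "(\<Union>p\<in>J. (case p of (c, r) \<Rightarrow> ball c r) - A) \<subseteq> W - A" by blast
  qed (use A W in auto)
  finally show ?thesis .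
qed

text \<open>The bound for finite families does not depend on the family, so it survives the
  increasing union of the first \<open>m\<close> balls of an enumeration. The empty family is split
  off because \<open>from_nat_into\<close> enumerates exactly \<open>I\<close> only when
  \<open>I\<close> is nonempty.\<close>

lemma emeasure_countable_UN_ball_le:
  assumes I: "countable I" "\<And>c r. (c, r) \<in> I \<Longrightarrow> 0 < r \<and> ball c r \<subseteq> W \<and>
      emeasure mu (ball c r) \<le> s * emeasure mu (ball c r - A)"
    and A: "A \<in> sets borel" and W: "W \<in> sets borel"
  shows "emeasure mu (\<Union>(c, r)\<in>I. ball c r) \<le> ennreal (K\<^sup>2) * s * emeasure mu (W - A)"
proof (cases "I = {}")
  case False
  define V where "V m = (\<Union>(c, r)\<in>from_nat_into I ` {..<m}. ball c r)" for m :: nat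
  have "emeasure mu (\<Union>m. V m) = (SUP m. emeasure mu (V m))"
  proof (rule SUP_emeasure_incseq[symmetric])
    show "range V \<subseteq> sets mu" unfolding V_def by (auto simp: split_beta)
    show "incseq V" unfolding V_def by (intro incseq_SucI UN_mono image_mono) auto
  qed
  also have "\<dots> \<le> ennreal (K\<^sup>2) * s * emeasure mu (W - A)"
  proof (rule SUP_least)
    fix m
    have "0 < r \<and> ball c r \<subseteq> W \<and> emeasure mu (ball c r) \<le> s * emeasure mu (ball c r - A)"
      if "(c, r) \<in> from_nat_into I ` {..<m}" for c r
      using that from_nat_into[OF False] by (intro I(2)) force
    then show "emeasure mu (V m) \<le> ennreal (K\<^sup>2) * s * emeasure mu (W - A)"
      unfolding V_def by (intro emeasure_finite_UN_ball_le A W) auto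
  qed
  also have "(\<Union>m. V m) = (\<Union>(c, r)\<in>range (from_nat_into I). ball c r)"
  proof -
    have "range (from_nat_into I) = (\<Union>m. from_nat_into I ` {..<m})" by auto
    then show ?thesis unfolding V_def by (simp only: UN_UN_flatten)
  qed
  finally show ?thesis using range_from_nat_into[OF False I(1)] by simp
qed simp

text \<open>Bad points inside a shrinking neighbourhood \<open>W k\<close> of \<open>A\<close> are covered by balls of total mass at
  most a constant times the mass of \<open>W k - A\<close>, which tends to 0. By Lindelof countably many
  balls suffice, so Vitali's lemma is only needed for finite families.\<close>

lemma null_set_non_density_points:
  assumes A: "closed A"
  shows "\<exists>N\<in>null_sets mu. {x \<in> A \<inter> ball a R. \<forall>\<delta>>0. \<exists>r. 0 < r \<and> r < \<delta> \<and>
           emeasure mu (ball x r) \<le> ennreal s * emeasure mu (ball x r - A)} \<subseteq> N"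
    (is "\<exists>N\<in>_. ?E \<subseteq> N")
proof (cases "A = {}")
  case False
  \<comment> \<open>Cutting with \<open>ball a R\<close> keeps the mass finite, as continuity from
    above requires below; the open \<open>1 / (k + 1)\<close>-neighbourhoods shrink to the closed
    set \<open>A\<close>.\<close>
  define W where "W k = ball a R \<inter> {y. infdist y A < 1 / Suc k}" for k
  have oW: "open (W k)" for k
    unfolding W_def by (intro open_Int open_ball open_Collect_less continuous_intros)
  have "\<exists>V. open V \<and> ?E \<subseteq> V \<and> emeasure mu V \<le> ennreal (K\<^sup>2) * ennreal s * emeasure mu (W k - A)" for k
  proof -
    define I where "I = {(x, r). 0 < r \<and> ball x r \<subseteq> W k \<and>
      emeasure mu (ball x r) \<le> ennreal s * emeasure mu (ball x r - A)}"
    obtain F where F: "F \<subseteq> (\<lambda>(x, r). ball x r) ` I" "countable F" "\<Union>F = (\<Union>(x, r)\<in>I. ball x r)"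
      by (rule Lindelof[of "(\<lambda>(x, r). ball x r) ` I"]) (auto simp: split_beta)
    obtain J where J: "J \<subseteq> I" "countable J" "F = (\<lambda>(x, r). ball x r) ` J"
      using F(1,2) by (meson countable_subset_image)
    have "x \<in> (\<Union>(x, r)\<in>I. ball x r)" if x: "x \<in> ?E" for x
    proof -
      have "x \<in> W k" using x unfolding W_def by auto
      then obtain \<delta> where d: "\<delta> > 0" "ball x \<delta> \<subseteq> W k" using oW open_contains_ball by metis
      obtain r where r: "0 < r" "r < \<delta>" "emeasure mu (ball x r) \<le> ennreal s * emeasure mu (ball x r - A)"
        using x d(1) by blast
      have "ball x r \<subseteq> ball x \<delta>" using r(2) by auto
      then have "(x, r) \<in> I" using r d(2) unfolding I_def by auto
      then show ?thesis using r(1) by force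
    qed
    moreover have "emeasure mu (\<Union>(x, r)\<in>J. ball x r) \<le> ennreal (K\<^sup>2) * ennreal s * emeasure mu (W k - A)"
      using J(1,2) A oW unfolding I_def by (intro emeasure_countable_UN_ball_le) auto
    moreover have "open (\<Union>(x, r)\<in>J. ball x r)" by auto
    moreover have "(\<Union>(x, r)\<in>J. ball x r) = (\<Union>(x, r)\<in>I. ball x r)" using F(3) J(3) by simp
    ultimately show ?thesis by (intro exI[of _ "\<Union>(x, r)\<in>J. ball x r"] conjI subsetI) simp_all
  qed
  then obtain V where *: "\<forall>k. open (V k) \<and> ?E \<subseteq> V k \<and>
      emeasure mu (V k) \<le> ennreal (K\<^sup>2) * ennreal s * emeasure mu (W k - A)"
    using choice[of "\<lambda>k V. open V \<and> ?E \<subseteq> V \<and>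
      emeasure mu V \<le> ennreal (K\<^sup>2) * ennreal s * emeasure mu (W k - A)"] by blast
  note V = conjunct1[OF *[rule_format]] conjunct1[OF conjunct2[OF *[rule_format]]]
    conjunct2[OF conjunct2[OF *[rule_format]]]
  have "(\<lambda>k. emeasure mu (W k - A)) \<longlonglongrightarrow> emeasure mu (\<Inter>k. W k - A)"
  proof (rule Lim_emeasure_decseq)
    show "range (\<lambda>k. W k - A) \<subseteq> sets mu" using oW A by auto
    have "W n \<subseteq> W m" if "m \<le> n" for m n
    proof -
      have "1 / real (Suc n) \<le> 1 / real (Suc m)" using that by (simp add: frac_le)
      then show ?thesis unfolding W_def by auto
    qed
    then show "decseq (\<lambda>k. W k - A)" unfolding decseq_def by blast
    have "emeasure mu (W k - A) \<le> emeasure mu (ball a R)" for k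
      unfolding W_def by (intro emeasure_mono) auto
    then show "emeasure mu (W k - A) \<noteq> \<infinity>" for k
      using emeasure_ball_finite[of a R] by (metis infinity_ennreal_def leD)
  qed
  moreover have "(\<Inter>k. W k - A) = {}"
  proof -
    have "y \<in> A" if "\<And>k. infdist y A < 1 / Suc k" for y
    proof -
      have "infdist y A = 0"
      proof (rule ccontr)
        assume "infdist y A \<noteq> 0"
        then have "0 < infdist y A" using infdist_nonneg[of y A] by linarith
        then obtain n where "1 / Suc n < infdist y A" using nat_approx_posE by blast
        then show False using that[of n] by linarith
      qed
      then show ?thesis using A False in_closed_iff_infdist_zero by blast
    qed
    then show ?thesis unfolding W_def by auto
  qed
  ultimately have "(\<lambda>k. emeasure mu (W k - A)) \<longlonglongrightarrow> 0" by (simp only: emeasure_empty)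
  then have "(\<lambda>k. ennreal (K\<^sup>2) * ennreal s * emeasure mu (W k - A)) \<longlonglongrightarrow> ennreal (K\<^sup>2) * ennreal s * 0"
    by (intro ennreal_tendsto_cmult) (auto simp: ennreal_mult_less_top)
  then have lim: "(\<lambda>k. ennreal (K\<^sup>2) * ennreal s * emeasure mu (W k - A)) \<longlonglongrightarrow> 0" by simp
  \<comment> \<open>The intersection of all \<open>V k\<close> is the null set sought: it contains
    every bad point, and its mass lies below every term of a sequence tending to 0.\<close>
  have "emeasure mu (\<Inter>k. V k) \<le> ennreal (K\<^sup>2) * ennreal s * emeasure mu (W k - A)" for k
    using V(1) by (intro order_trans[OF emeasure_mono V(3)]) auto
  then have "emeasure mu (\<Inter>k. V k) = 0"
    using LIMSEQ_le_const[OF lim, of "emeasure mu (\<Inter>k. V k)"] by auto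
  then have "(\<Inter>k. V k) \<in> null_sets mu" using V(1) by (intro null_setsI) auto
  then show ?thesis by (intro bexI[of _ "\<Inter>k. V k"] INT_greatest V(2))
next
  case True
  then show ?thesis by auto
qed

text \<open>If the density limit fails at \<open>x\<close>, then for some \<open>n\<close> the
  complement of \<open>A\<close> fills at least the fraction \<open>1 / n\<close> of arbitrarily
  small balls around \<open>x\<close>. Such points form a countable union of null sets
  \<open>E m n\<close>; the index \<open>m\<close> localises to balls of finite mass around an
  arbitrary base point.\<close>

lemma AE_closed_density:
  assumes "closed A"
  shows "AE x in mu. x \<in> A \<longrightarrow>
    ((\<lambda>r. measure mu (ball x r - A) / measure mu (ball x r)) \<longlongrightarrow> 0) (at_right 0)"
proof -
  define a where "a = (undefined :: 'a)"
  define E where "E m n = {x \<in> A \<inter> ball a (real m). \<forall>\<delta>>0. \<exists>r. 0 < r \<and> r < \<delta> \<and>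
    emeasure mu (ball x r) \<le> ennreal (real n) * emeasure mu (ball x r - A)}" for m n :: nat
  have "AE x in mu. x \<notin> E m n" for m n
  proof -
    obtain N where "N \<in> null_sets mu" "E m n \<subseteq> N"
      using null_set_non_density_points[OF assms, of a "real m" "real n"] unfolding E_def by blast
    then show ?thesis by (auto intro!: AE_I'[of N])
  qed
  then have "AE x in mu. \<forall>m n. x \<notin> E m n" by (simp add: AE_all_countable)
  then show ?thesis
  proof (rule AE_mp, intro AE_I2 impI)
    fix x assume x: "\<forall>m n. x \<notin> E m n" "x \<in> A"
    obtain m where m: "x \<in> ball a (real m)" using reals_Archimedean2 by auto
    show "((\<lambda>r. measure mu (ball x r - A) / measure mu (ball x r)) \<longlongrightarrow> 0) (at_right 0)"
    proof (rule tendstoI)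
      fix e :: real assume e: "0 < e"
      obtain n where n: "inverse (Suc n) < e" using reals_Archimedean[OF e] by auto
      \<comment> \<open>Avoiding \<open>E m (Suc n)\<close> reverses the inequality for all small
        radii, so the ratio falls below \<open>inverse (Suc n)\<close> and hence below
        \<open>e\<close>.\<close>
      obtain \<delta> where d: "\<delta> > 0" "\<And>r. 0 < r \<Longrightarrow> r < \<delta> \<Longrightarrow>
          \<not> emeasure mu (ball x r) \<le> ennreal (real (Suc n)) * emeasure mu (ball x r - A)"
        using x m unfolding E_def by blast
      have "dist (measure mu (ball x r - A) / measure mu (ball x r)) 0 < e" if r: "0 < r" "r < \<delta>" for r
      proof -
        have "emeasure mu (ball x r) = ennreal (measure mu (ball x r))"
             "emeasure mu (ball x r - A) = ennreal (measure mu (ball x r - A))"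
          using emeasure_ball_finite[of x r] fmeasurable_ball_Diff[of A x r] assms
          by (auto simp: emeasure_eq_ennreal_measure fmeasurable_def)
        then have "real (Suc n) * measure mu (ball x r - A) < measure mu (ball x r)"
          using d(2)[OF r] by (simp flip: ennreal_mult del: of_nat_Suc)
        then have "measure mu (ball x r - A) / measure mu (ball x r) < inverse (Suc n)"
          using measure_ball_pos[OF r(1), of x] by (simp add: field_simps)
        then show ?thesis using n by simp
      qed
      then show "\<forall>\<^sub>F r in at_right 0. dist (measure mu (ball x r - A) / measure mu (ball x r)) 0 < e"
        using d(1) by (auto simp: eventually_at_right intro!: exI[of _ \<delta>])
    qed
  qed
qed

section \<open>Calculus of \<mu>-neighbourhoods and accumulation points\<close>

lemma mu_nbhd_UNIV: "mu_nbhd mu x UNIV"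
  unfolding mu_nbhd_def by (intro conjI exI[of _ UNIV]) simp_all

text \<open>The complement of \<open>B \<inter> B'\<close> is the union of the two complements, so
  by subadditivity its relative mass in a ball is at most the sum of two quantities tending to
  0.\<close>

lemma mu_nbhd_Int:
  assumes "mu_nbhd mu x U" "mu_nbhd mu x V"
  shows "mu_nbhd mu x (U \<inter> V)"
proof -
  obtain B where B: "B \<in> sets borel" "B \<subseteq> U"
    "((\<lambda>r. measure mu (ball x r - B) / measure mu (ball x r)) \<longlongrightarrow> 0) (at_right 0)"
    using assms(1) unfolding mu_nbhd_def by blast
  obtain B' where B': "B' \<in> sets borel" "B' \<subseteq> V"
    "((\<lambda>r. measure mu (ball x r - B') / measure mu (ball x r)) \<longlongrightarrow> 0) (at_right 0)"
    using assms(2) unfolding mu_nbhd_def by blast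
  have le: "measure mu (ball x r - (B \<inter> B')) / measure mu (ball x r) \<le>
      measure mu (ball x r - B) / measure mu (ball x r) + measure mu (ball x r - B') / measure mu (ball x r)" for r
  proof -
    have "measure mu (ball x r - (B \<inter> B')) \<le> measure mu (ball x r - B) + measure mu (ball x r - B')"
      using measure_Un_le[of "ball x r - B" mu "ball x r - B'"] B(1) B'(1) by (simp add: Diff_Int)
    then show ?thesis by (simp add: divide_right_mono flip: add_divide_distrib)
  qed
  have "((\<lambda>r. measure mu (ball x r - (B \<inter> B')) / measure mu (ball x r)) \<longlongrightarrow> 0) (at_right 0)"
  proof (rule tendsto_sandwich)
    show "\<forall>\<^sub>F r in at_right 0. measure mu (ball x r - (B \<inter> B')) / measure mu (ball x r) \<le>
        measure mu (ball x r - B) / measure mu (ball x r) + measure mu (ball x r - B') / measure mu (ball x r)"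
      using le by (intro always_eventually allI)
    show "\<forall>\<^sub>F r in at_right 0. 0 \<le> measure mu (ball x r - (B \<inter> B')) / measure mu (ball x r)"
      by (intro always_eventually allI) simp
    show "((\<lambda>r. measure mu (ball x r - B) / measure mu (ball x r) +
        measure mu (ball x r - B') / measure mu (ball x r)) \<longlongrightarrow> 0) (at_right 0)"
      using tendsto_add[OF B(3) B'(3)] by simp
  qed (rule tendsto_const)
  then show ?thesis
    using assms B(1,2) B'(1,2) unfolding mu_nbhd_def
    by (intro conjI exI[of _ "B \<inter> B'"]) (simp, blast, blast)
qed

lemma mu_nbhd_INT:
  assumes "finite I" "\<And>i. i \<in> I \<Longrightarrow> mu_nbhd mu x (U i)"
  shows "mu_nbhd mu x (\<Inter>i\<in>I. U i)"
  using assms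
proof (induction I)
  case empty
  then show ?case by (simp add: mu_nbhd_UNIV)
next
  case (insert i I)
  then have "mu_nbhd mu x (U i \<inter> (\<Inter>i\<in>I. U i))" by (intro mu_nbhd_Int) auto
  then show ?case by simp
qed

lemma mu_nbhd_borel_subset:
  assumes "mu_nbhd mu x U"
  obtains B where "B \<in> sets borel" "mu_nbhd mu x B" "B \<subseteq> U"
proof -
  obtain B where B: "B \<in> sets borel" "B \<subseteq> U"
    "((\<lambda>r. measure mu (ball x r - B) / measure mu (ball x r)) \<longlongrightarrow> 0) (at_right 0)" "x \<in> U"
    using assms unfolding mu_nbhd_def by blast
  \<comment> \<open>The Borel witness \<open>B\<close> may miss \<open>x\<close> itself; adding the
    point keeps it Borel and inside \<open>U\<close>.\<close>
  then have "mu_nbhd mu x (insert x B)" unfolding mu_nbhd_def by blast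
  then show thesis using B by (intro that[of "insert x B"]) auto
qed

text \<open>Used to pass from the whole domain \<open>C\<close> to a piece \<open>A\<close> at its
  density points: a test neighbourhood \<open>U\<close> is replaced by
  \<open>A \<inter> U\<close>.\<close>

lemma mu_acc_Int_nbhd:
  assumes "mu_acc mu C x" "mu_nbhd mu x A"
  shows "mu_acc mu (C \<inter> A) x"
  unfolding mu_acc_def
proof (intro allI impI)
  fix U assume "mu_nbhd mu x U"
  then have "C \<inter> (A \<inter> U) - {x} \<noteq> {}"
    using assms(1) mu_nbhd_Int[OF assms(2)] unfolding mu_acc_def by blast
  then show "C \<inter> A \<inter> U - {x} \<noteq> {}" by (simp add: Int_assoc)
qed

end

section \<open>Lipschitz branches of multiset-valued maps\<close>

lemma sum_mset_nonneg_real: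
  fixes f :: "'b \<Rightarrow> real"
  assumes "\<And>x. 0 \<le> f x" shows "0 \<le> (\<Sum>x\<in>#S. f x)"
  using assms by (induction S) simp_all

text \<open>Zipping two enumerations of equal length gives a matching. Thus the infimum defining
  \<open>AQ_dist\<close> runs over a nonempty set.\<close>

lemma matching_exists:
  assumes "size S = size T"
  shows "\<exists>Z. image_mset fst Z = S \<and> image_mset snd Z = T"
proof -
  obtain xs ys where "mset xs = S" "mset ys = T" using ex_mset by metis
  then have "image_mset fst (mset (zip xs ys)) = S \<and> image_mset snd (mset (zip xs ys)) = T"
    using assms by (auto simp flip: mset_map size_mset)
  then show ?thesis by blast
qed

context
  fixes M :: "'m set" and d :: "'m \<Rightarrow> 'm \<Rightarrow> real"
  assumes metric: "Metric_space M d"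
begin

interpretation Metric_space M d by (rule metric)

lemma AQ_dist_nonneg: "size S = size T \<Longrightarrow> 0 \<le> AQ_dist d S T"
  unfolding AQ_dist_def using matching_exists[of S T]
  by (intro cInf_greatest) (auto intro!: sum_mset_nonneg_real)

text \<open>As \<open>t\<close> exceeds the infimum, some matching has total cost below
  \<open>t\<close>, and each single cost is bounded by the total. This stands in for the choice of
  an optimal matching.\<close>

lemma AQ_dist_less_matching:
  assumes "AQ_dist d S T < t" "size S = size T"
  obtains Z where "image_mset fst Z = S" "image_mset snd Z = T" "\<And>p q. (p, q) \<in># Z \<Longrightarrow> d p q < t"
proof -
  let ?V = "{sqrt (\<Sum>p\<in>#Z. (d (fst p) (snd p))\<^sup>2) | Z. image_mset fst Z = S \<and> image_mset snd Z = T}"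
  have "?V \<noteq> {}" using matching_exists[OF assms(2)] by blast
  moreover have "Inf ?V < t" using assms(1) unfolding AQ_dist_def .
  ultimately have "\<exists>v\<in>?V. v < t" by (rule cInf_lessD)
  then obtain v where "v \<in> ?V" "v < t" by (rule bexE) (rule that)
  then obtain Z where "v = sqrt (\<Sum>p\<in>#Z. (d (fst p) (snd p))\<^sup>2)"
    and Z: "image_mset fst Z = S" "image_mset snd Z = T" unfolding mem_Collect_eq by (elim exE conjE) (rule that)
  with \<open>v < t\<close> have lt: "sqrt (\<Sum>p\<in>#Z. (d (fst p) (snd p))\<^sup>2) < t" by simp
  have "d p q < t" if pq: "(p, q) \<in># Z" for p q
  proof -
    obtain Z' where "Z = add_mset (p, q) Z'" using pq by (metis multi_member_split)
    moreover have "0 \<le> (\<Sum>p\<in>#Z'. (d (fst p) (snd p))\<^sup>2)" by (intro sum_mset_nonneg_real) simp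
    ultimately have "(d p q)\<^sup>2 \<le> (\<Sum>p\<in>#Z. (d (fst p) (snd p))\<^sup>2)" by simp
    then have "d p q \<le> sqrt (\<Sum>p\<in>#Z. (d (fst p) (snd p))\<^sup>2)" by (rule real_le_rsqrt)
    then show ?thesis using lt by linarith
  qed
  then show thesis using that Z by blast
qed

text \<open>Pairing \<open>f p\<close> with \<open>h p\<close> is one admissible matching, and the
  Euclidean norm of nonnegative costs is at most their sum.\<close>

lemma AQ_dist_image_le: "AQ_dist d (image_mset f S) (image_mset h S) \<le> (\<Sum>p\<in>#S. d (f p) (h p))"
proof -
  let ?Z = "image_mset (\<lambda>p. (f p, h p)) S"
  have "AQ_dist d (image_mset f S) (image_mset h S) \<le> sqrt (\<Sum>p\<in>#?Z. (d (fst p) (snd p))\<^sup>2)"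
    unfolding AQ_dist_def
  proof (rule cInf_lower)
    show "bdd_below {sqrt (\<Sum>p\<in>#Z. (d (fst p) (snd p))\<^sup>2) | Z.
        image_mset fst Z = image_mset f S \<and> image_mset snd Z = image_mset h S}"
      by (intro bdd_belowI[of _ 0]) (auto intro!: sum_mset_nonneg_real)
  qed (auto intro!: exI[of _ ?Z] simp: multiset.map_comp comp_def)
  also have "\<dots> = sqrt (\<Sum>p\<in>#S. (d (f p) (h p))\<^sup>2)" by (simp add: multiset.map_comp comp_def)
  also have "\<dots> \<le> (\<Sum>p\<in>#S. d (f p) (h p))"
  proof -
    \<comment> \<open>Nonnegativity is carried through the induction because it controls the cross
      term of the squared sum.\<close>
    have "0 \<le> (\<Sum>p\<in>#S. d (f p) (h p)) \<and>
        (\<Sum>p\<in>#S. (d (f p) (h p))\<^sup>2) \<le> (\<Sum>p\<in>#S. d (f p) (h p))\<^sup>2"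
    proof (induction S)
      case (add p S)
      then show ?case by (simp add: power2_sum add_increasing2)
    qed simp
    then show ?thesis by (intro real_le_lsqrt) auto
  qed
  finally show ?thesis .
qed

lemma AQ_dist_image_le_const:
  assumes "\<And>p. p \<in># S \<Longrightarrow> d (f p) (h p) \<le> t"
  shows "AQ_dist d (image_mset f S) (image_mset h S) \<le> real (size S) * t"
proof -
  have "(\<Sum>p\<in>#S. d (f p) (h p)) \<le> (\<Sum>p\<in>#S. t)" using assms by (intro sum_mset_mono)
  then show ?thesis using AQ_dist_image_le[of f S h] by (simp add: mult.commute)
qed

text \<open>Matched points lie within \<open>\<delta> / 4\<close> of each other while distinct points of one value
  are at least \<open>\<delta>\<close> apart, so the matching of \<open>g y\<close> with \<open>g x0\<close> is forced.\<close>

lemma AQ_Lipschitz_selection: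
  assumes g: "g ` A \<subseteq> AQ M Q" and x0: "x0 \<in> A"
    and sep: "\<And>y p q. y \<in> A \<Longrightarrow> p \<in># g y \<Longrightarrow> q \<in># g y \<Longrightarrow> p \<noteq> q \<Longrightarrow> \<delta> \<le> d p q"
    and close: "\<And>y z. y \<in> A \<Longrightarrow> z \<in> A \<Longrightarrow> AQ_dist d (g y) (g z) < \<delta> / 4"
  obtains f where "\<And>y. y \<in> A \<Longrightarrow> g y = image_mset (\<lambda>p. f p y) (g x0)"
    "\<And>y. y \<in> A \<Longrightarrow> inj_on (\<lambda>p. f p y) (set_mset (g x0))"
    "\<And>p y z. p \<in># g x0 \<Longrightarrow> y \<in> A \<Longrightarrow> z \<in> A \<Longrightarrow> d (f p y) (f p z) \<le> AQ_dist d (g y) (g z)"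
proof -
  \<comment> \<open>The radius \<open>\<delta> / 2\<close> is the largest for which separation still
    forces uniqueness by the triangle inequality. It leaves room for two steps of length below
    \<open>\<delta> / 4\<close>, as the Lipschitz estimate needs.\<close>
  define f where "f p y = (SOME q. q \<in># g y \<and> d p q < \<delta> / 2)" for p y
  have inM: "p \<in> M" if "p \<in># g y" "y \<in> A" for p y using g that unfolding AQ_def by auto
  have sz: "size (g y) = size (g z)" if "y \<in> A" "z \<in> A" for y z using g that unfolding AQ_def by auto
  have \<delta>: "0 < \<delta>" using close[OF x0 x0] AQ_dist_nonneg[of "g x0" "g x0"] by simp
  have uniq: "f p y = q" if "y \<in> A" "p \<in># g x0" "q \<in># g y" "d p q < \<delta> / 2" for p q y
  proof -
    let ?q = "f p y"
    have q: "?q \<in># g y \<and> d p ?q < \<delta> / 2" unfolding f_def using that by (intro someI) auto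
    have "d ?q q \<le> d p ?q + d p q"
      using triangle[of ?q p q] that q inM[OF _ x0] inM[of _ y] by (simp add: commute)
    then have "d ?q q < \<delta>" using q that by linarith
    then show ?thesis using sep[of y ?q q] that q by fastforce
  qed
  have match: "\<exists>Z. image_mset fst Z = g x0 \<and> image_mset snd Z = g y \<and>
      (\<forall>(p, q) \<in># Z. d p q < \<delta> / 4 \<and> f p y = q)" if y: "y \<in> A" for y
  proof -
    obtain Z where Z: "image_mset fst Z = g x0" "image_mset snd Z = g y"
      "\<And>p q. (p, q) \<in># Z \<Longrightarrow> d p q < \<delta> / 4"
      by (rule AQ_dist_less_matching[OF close[OF x0 y] sz[OF x0 y]]) (rule that)
    have "f p y = q" if "(p, q) \<in># Z" for p q
    proof (rule uniq[OF y])
      show "p \<in># g x0" "q \<in># g y" unfolding Z(1,2)[symmetric] using that by force+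
      show "d p q < \<delta> / 2" using Z(3)[OF that] \<delta> by simp
    qed
    then show ?thesis using Z by blast
  qed
  have f_in: "f p y \<in># g y \<and> d p (f p y) < \<delta> / 4" if "y \<in> A" "p \<in># g x0" for p y
  proof -
    obtain Z where Z: "image_mset fst Z = g x0" "image_mset snd Z = g y"
      "\<forall>(p, q) \<in># Z. d p q < \<delta> / 4 \<and> f p y = q" using match[OF \<open>y \<in> A\<close>] by blast
    obtain q where pq: "(p, q) \<in># Z" using \<open>p \<in># g x0\<close> unfolding Z(1)[symmetric] by force
    then have "q \<in># g y" unfolding Z(2)[symmetric] by force
    then show ?thesis using Z(3) pq by auto
  qed
  show thesis
  proof (rule that)
    fix y assume y: "y \<in> A"
    obtain Z where Z: "image_mset fst Z = g x0" "image_mset snd Z = g y"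
      "\<forall>(p, q) \<in># Z. d p q < \<delta> / 4 \<and> f p y = q" using match[OF y] by blast
    have "image_mset snd Z = image_mset (\<lambda>pq. f (fst pq) y) Z"
      using Z(3) by (intro image_mset_cong) auto
    then show "g y = image_mset (\<lambda>p. f p y) (g x0)"
      unfolding Z(1,2)[symmetric] by (simp add: multiset.map_comp comp_def)
    show "inj_on (\<lambda>p. f p y) (set_mset (g x0))"
    proof (rule inj_onI, rule ccontr)
      fix p q assume pq: "p \<in># g x0" "q \<in># g x0" "f p y = f q y" "p \<noteq> q"
      \<comment> \<open>Two branches meeting at \<open>y\<close> would put distinct points of
        \<open>g x0\<close> less than \<open>\<delta> / 2\<close> apart, against the separation at
        \<open>x0\<close>.\<close>
      have "d p q \<le> d p (f p y) + d q (f q y)"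
        using triangle[of p "f p y" q] pq f_in[OF y] inM[OF _ x0] inM[OF _ y] by (metis commute)
      then show False using f_in[OF y pq(1)] f_in[OF y pq(2)] sep[OF x0 pq(1,2,4)] \<delta> by linarith
    qed
  next
    fix p y z assume p: "p \<in># g x0" and y: "y \<in> A" and z: "z \<in> A"
    show "d (f p y) (f p z) \<le> AQ_dist d (g y) (g z)"
    \<comment> \<open>It suffices to bound by every \<open>t\<close> strictly between the distance
      and \<open>\<delta> / 4\<close>. A matching with costs below \<open>t\<close> pairs
      \<open>f p y\<close> with a point of \<open>g z\<close> within \<open>\<delta> / 2\<close> of
      \<open>p\<close>, which by uniqueness is \<open>f p z\<close>.\<close>
    proof (rule dense_ge_bounded)
      show "AQ_dist d (g y) (g z) < \<delta> / 4" using close[OF y z] .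
      fix t assume t: "AQ_dist d (g y) (g z) < t" "t < \<delta> / 4"
      obtain Z where Z: "image_mset fst Z = g y" "image_mset snd Z = g z"
        "\<And>p q. (p, q) \<in># Z \<Longrightarrow> d p q < t"
        by (rule AQ_dist_less_matching[OF t(1) sz[OF y z]]) (rule that)
      have fy: "f p y \<in># g y" using f_in[OF y p] by blast
      then obtain q where pq: "(f p y, q) \<in># Z" unfolding Z(1)[symmetric] by force
      then have q: "q \<in># g z" unfolding Z(2)[symmetric] by force
      have "d p q \<le> d p (f p y) + d (f p y) q"
        using triangle[of p "f p y" q] inM[OF p x0] inM[OF fy y] inM[OF q z] by blast
      then have "d p q < \<delta> / 2" using f_in[OF y p] Z(3)[OF pq] t(2) by linarith
      then have "f p z = q" using uniq[OF z p q] by blast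
      then show "d (f p y) (f p z) \<le> t" using Z(3)[OF pq] by simp
    qed
  qed
qed

text \<open>Points \<open>p\<close>, \<open>q\<close> of the limit value with
  \<open>0 < d p q < \<delta>\<close> would be matched with \<open>p'\<close>, \<open>q'\<close> in
  a nearby value that are neither equal nor \<open>\<delta>\<close> apart.\<close>

lemma closed_separated_points:
  fixes g :: "'a::metric_space \<Rightarrow> 'm multiset"
  assumes "closed C" and g: "g ` C \<subseteq> AQ M Q"
    and lip: "\<And>y z. y \<in> C \<Longrightarrow> z \<in> C \<Longrightarrow> AQ_dist d (g y) (g z) \<le> L * dist y z"
  shows "closed {y \<in> C. \<forall>p\<in>#g y. \<forall>q\<in>#g y. p \<noteq> q \<longrightarrow> \<delta> \<le> d p q}" (is "closed ?S")
  unfolding closed_sequential_limits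
proof (intro allI impI, elim conjE)
  fix s y assume s: "\<forall>n. s n \<in> ?S" and lim: "s \<longlonglongrightarrow> y"
  have y: "y \<in> C" using \<open>closed C\<close> s lim unfolding closed_sequential_limits by blast
  have "\<delta> \<le> d p q" if p: "p \<in># g y" and q: "q \<in># g y" and "p \<noteq> q" for p q
  proof (rule ccontr)
    assume "\<not> \<delta> \<le> d p q"
    \<comment> \<open>The first bound keeps \<open>p'\<close> and \<open>q'\<close> distinct, the
      second keeps \<open>d p' q'\<close> below \<open>\<delta>\<close>.\<close>
    define \<eta> where "\<eta> = min (d p q / 2) ((\<delta> - d p q) / 2)"
    have inM: "p \<in> M" "q \<in> M" using g y p q unfolding AQ_def by auto
    then have \<eta>: "0 < \<eta>" using \<open>p \<noteq> q\<close> \<open>\<not> \<delta> \<le> d p q\<close> unfolding \<eta>_def by simp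
    have "(\<lambda>n. L * dist y (s n)) \<longlonglongrightarrow> L * dist y y"
      using lim by (intro tendsto_intros)
    then have "\<forall>\<^sub>F n in sequentially. L * dist y (s n) < \<eta>"
      using \<eta> by (intro order_tendstoD) auto
    then obtain n where "L * dist y (s n) < \<eta>" by (auto simp: eventually_sequentially)
    moreover have sn: "s n \<in> C" using s by blast
    ultimately have "AQ_dist d (g y) (g (s n)) < \<eta>" using lip[OF y sn] by linarith
    moreover have "size (g y) = size (g (s n))" using g y sn unfolding AQ_def by auto
    ultimately obtain Z where Z: "image_mset fst Z = g y" "image_mset snd Z = g (s n)"
      "\<And>p q. (p, q) \<in># Z \<Longrightarrow> d p q < \<eta>" by (rule AQ_dist_less_matching) (rule that)
    obtain p' q' where pq: "(p, p') \<in># Z" "(q, q') \<in># Z" using p q unfolding Z(1)[symmetric] by force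
    then have pq': "p' \<in># g (s n)" "q' \<in># g (s n)" unfolding Z(2)[symmetric] by force+
    then have inM': "p' \<in> M" "q' \<in> M" using g sn unfolding AQ_def by auto
    have "d p q \<le> d p p' + d p' q' + d q q'"
      using triangle[of p p' q] triangle[of p' q' q] inM inM' by (simp add: commute)
    moreover have "d p' q' \<le> d p p' + d p q + d q q'"
      using triangle[of p' p q'] triangle[of p q q'] inM inM' by (simp add: commute)
    moreover have "p' = q' \<or> \<delta> \<le> d p' q'" using s pq' by blast
    moreover have "d p' q' = 0" if "p' = q'" using inM' that by simp
    moreover have "d p p' < d p q / 2" "d q q' < d p q / 2"
        "d p p' < (\<delta> - d p q) / 2" "d q q' < (\<delta> - d p q) / 2"
      using Z(3)[OF pq(1)] Z(3)[OF pq(2)] unfolding \<eta>_def by simp_all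
    ultimately show False by argo
  qed
  then show "y \<in> ?S" using y by blast
qed

end

section \<open>Differentiability of multiset-valued maps\<close>

lemma germ_class_germ_rep:
  assumes "c \<in> germ_classes mu N e x P" "(B, F) \<in> c"
  shows "germ_rep mu N e x P B F"
  using assms unfolding germ_classes_def germ_class_def by blast

text \<open>The constant in \<open>lipschitz_into\<close> is an arbitrary real; raising it to
  \<open>max L 1\<close> makes it positive, so that radii can be divided by it and constants of
  several branches can be added.\<close>

lemma lipschitz_intoE:
  assumes "lipschitz_into N e A f"
  obtains L where "0 < L" "\<And>y z. y \<in> A \<Longrightarrow> z \<in> A \<Longrightarrow> e (f y) (f z) \<le> L * dist y z"
proof -
  obtain L where L: "\<And>y z. y \<in> A \<Longrightarrow> z \<in> A \<Longrightarrow> e (f y) (f z) \<le> L * dist y z"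
    using assms unfolding lipschitz_into_def by blast
  have "e (f y) (f z) \<le> max L 1 * dist y z" if "y \<in> A" "z \<in> A" for y z
    using L[OF that] by (rule order_trans) (intro mult_right_mono, auto)
  then show thesis by (intro that[of "max L 1"]) auto
qed

text \<open>The whole space is an admissible neighbourhood in the infimum, and on it the difference
  quotients are at most \<open>L\<close>. This supplies the limsup condition in
  \<open>acc_bounded_set\<close> for the branches.\<close>

lemma lipschitz_mu_limsup_finite:
  assumes "mu_nbhd mu x UNIV" "lipschitz_into N e A f" "x \<in> A"
  shows "mu_limsup mu A (\<lambda>y. e (f y) (f x) / dist y x) x < \<infinity>"
proof -
  obtain L where L: "\<And>y z. y \<in> A \<Longrightarrow> z \<in> A \<Longrightarrow> e (f y) (f z) \<le> L * dist y z"
    by (rule lipschitz_intoE[OF assms(2)]) (rule that)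
  have "mu_limsup mu A (\<lambda>y. e (f y) (f x) / dist y x) x \<le>
      (SUP y \<in> UNIV \<inter> A - {x}. ereal (e (f y) (f x) / dist y x))"
    unfolding mu_limsup_def using assms(1) by (intro INF_lower) simp
  also have "\<dots> \<le> ereal L"
    using L \<open>x \<in> A\<close> by (intro SUP_least) (auto simp: divide_le_eq)
  finally show ?thesis by (rule le_less_trans) simp
qed

text \<open>The germ sought is the sum \<open>FF\<close> of representatives \<open>F p\<close> of
  the differentials of the branches. Injectivity at \<open>x\<close> means that equal points of
  \<open>g x\<close> come from the same \<open>p\<close>, hence carry the same germ, as
  \<open>DQ\<close> demands. Since \<open>A\<close> is a \<mu>-neighbourhood of \<open>x\<close>,
  approximation on \<open>A\<close> yields approximation on \<open>C\<close>.\<close>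

lemma approx_diff_DQ:
  fixes mu :: "'a::polish_space measure" and g :: "'a \<Rightarrow> 'm multiset"
  assumes doubling: "doubling_mms K mu" and metric: "Metric_space M d" and "Q \<ge> 1"
    and D: "approx_distribution mu M d D"
    and A: "mu_nbhd mu x A" "A \<subseteq> C" and C: "mu_acc mu C x" "g ` C \<subseteq> AQ M Q"
    and S: "size S = Q" and gf: "\<And>y. y \<in> A \<Longrightarrow> g y = image_mset (\<lambda>p. f p y) S"
    and inj: "inj_on (\<lambda>p. f p x) (set_mset S)"
    and diff: "\<And>p. p \<in># S \<Longrightarrow> approx_diff mu d D A (f p) x"
  shows "approx_diff mu (AQ_dist d) (DQ mu M d Q D) C g x"
proof -
  interpret Metric_space M d by (rule metric)
  have xA: "x \<in> A" using A unfolding mu_nbhd_def by blast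
  have "\<forall>p\<in>#S. \<exists>cBF. (x, f p x, fst cBF) \<in> D \<and> (fst (snd cBF), snd (snd cBF)) \<in> fst cBF \<and>
      mu_lim mu (A \<inter> fst (snd cBF)) (\<lambda>y. d (f p y) (snd (snd cBF) y) / dist y x) x 0"
  proof
    fix p assume "p \<in># S"
    then obtain c B F where "(x, f p x, c) \<in> D" "(B, F) \<in> c"
        "mu_lim mu (A \<inter> B) (\<lambda>y. d (f p y) (F y) / dist y x) x 0"
      using diff[of p] unfolding approx_diff_def by blast
    then show "\<exists>cBF. (x, f p x, fst cBF) \<in> D \<and> (fst (snd cBF), snd (snd cBF)) \<in> fst cBF \<and>
        mu_lim mu (A \<inter> fst (snd cBF)) (\<lambda>y. d (f p y) (snd (snd cBF) y) / dist y x) x 0"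
      by (intro exI[of _ "(c, B, F)"]) simp
  qed
  from bchoice[OF this] obtain cBF where cBF: "\<forall>p\<in>#S. (x, f p x, fst (cBF p)) \<in> D \<and>
      (fst (snd (cBF p)), snd (snd (cBF p))) \<in> fst (cBF p) \<and>
      mu_lim mu (A \<inter> fst (snd (cBF p))) (\<lambda>y. d (f p y) (snd (snd (cBF p)) y) / dist y x) x 0"
    by (rule exE) (rule that)
  define c B F where "c p = fst (cBF p)" and "B p = fst (snd (cBF p))" and "F p = snd (snd (cBF p))" for p
  have c: "(x, f p x, c p) \<in> D" "(B p, F p) \<in> c p"
      "mu_lim mu (A \<inter> B p) (\<lambda>y. d (f p y) (F p y) / dist y x) x 0" if "p \<in># S" for p
    using cBF that unfolding c_def B_def F_def by auto
  have rep: "germ_rep mu M d x (f p x) (B p) (F p)" if "p \<in># S" for p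
    using c(1,2)[OF that] D unfolding approx_distribution_def by (blast intro: germ_class_germ_rep)
  define BB where "BB = (\<Inter>p\<in>set_mset S. B p)"
  define FF where "FF y = image_mset (\<lambda>p. F p y) S" for y
  have BB: "mu_nbhd mu x BB"
    unfolding BB_def using rep by (intro mu_nbhd_INT[OF doubling]) (auto simp: germ_rep_def)
  have FM: "F p y \<in> M" if "p \<in># S" "y \<in> BB" for p y
    using rep[OF that(1)] that unfolding germ_rep_def lipschitz_into_def BB_def by blast
  have FF_AQ: "FF y \<in> AQ M Q" if "y \<in> BB" for y
    using FM that S unfolding FF_def AQ_def by auto
  have gx: "g x = FF x"
    unfolding FF_def gf[OF xA] using rep by (intro image_mset_cong) (simp add: germ_rep_def)
  have Q: "0 < real (size S)" using \<open>Q \<ge> 1\<close> S by simp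
  have "lipschitz_into (AQ M Q) (AQ_dist d) BB FF"
  proof -
    have "\<forall>p\<in>#S. \<exists>L>0. \<forall>y\<in>B p. \<forall>z\<in>B p. d (F p y) (F p z) \<le> L * dist y z"
    proof
      fix p assume "p \<in># S"
      then have "lipschitz_into M d (B p) (F p)" using rep unfolding germ_rep_def by blast
      then obtain L where "0 < L" "\<And>y z. y \<in> B p \<Longrightarrow> z \<in> B p \<Longrightarrow> d (F p y) (F p z) \<le> L * dist y z"
        by (rule lipschitz_intoE) (rule that)
      then show "\<exists>L>0. \<forall>y\<in>B p. \<forall>z\<in>B p. d (F p y) (F p z) \<le> L * dist y z" by blast
    qed
    from bchoice[OF this] obtain L where L: "\<forall>p\<in>#S. 0 < L p \<and> (\<forall>y\<in>B p. \<forall>z\<in>B p. d (F p y) (F p z) \<le> L p * dist y z)"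
      by (rule exE) (rule that)
    \<comment> \<open>The sum over the finite support serves as a common Lipschitz constant for all
      branches.\<close>
    have le: "L p \<le> (\<Sum>p\<in>set_mset S. L p)" if "p \<in># S" for p
      using that L by (intro member_le_sum) (auto intro: less_imp_le)
    have "AQ_dist d (FF y) (FF z) \<le> real (size S) * (\<Sum>p\<in>set_mset S. L p) * dist y z"
      if "y \<in> BB" "z \<in> BB" for y z
      unfolding FF_def mult.assoc
    proof (rule AQ_dist_image_le_const[OF metric])
      fix p assume p: "p \<in># S"
      have "d (F p y) (F p z) \<le> L p * dist y z" using L p that unfolding BB_def by blast
      also have "\<dots> \<le> (\<Sum>p\<in>set_mset S. L p) * dist y z" by (intro mult_right_mono le p) simp
      finally show "d (F p y) (F p z) \<le> (\<Sum>p\<in>set_mset S. L p) * dist y z" .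
    qed
    then show ?thesis using FF_AQ unfolding lipschitz_into_def by blast
  qed
  then have repQ: "germ_rep mu (AQ M Q) (AQ_dist d) x (g x) BB FF"
    using BB gx unfolding germ_rep_def by simp
  define cc where "cc = germ_class mu (AQ M Q) (AQ_dist d) x (g x) BB FF"
  have "mu_lim mu (BB \<inter> BB) (\<lambda>y. AQ_dist d (FF y) (FF y) / dist y x) x 0"
  proof -
    have "AQ_dist d (FF y) (FF y) = 0" if "y \<in> BB" for y
    proof (rule antisym)
      have "AQ_dist d (FF y) (FF y) \<le> real (size S) * 0"
        unfolding FF_def using FM that by (intro AQ_dist_image_le_const[OF metric]) simp
      then show "AQ_dist d (FF y) (FF y) \<le> 0" by simp
    qed (simp add: AQ_dist_nonneg[OF metric])
    then show ?thesis unfolding mu_lim_def using BB by auto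
  qed
  then have cc: "(BB, FF) \<in> cc" using repQ unfolding cc_def germ_class_def by blast
  have "(x, g x, cc) \<in> DQ mu M d Q D"
  proof -
    \<comment> \<open>\<open>DQ\<close> indexes points by \<open>i < Q\<close>; the list
      \<open>ps\<close> turns the index set \<open>S\<close> into such a numbering, repeating each
      \<open>p\<close> according to its multiplicity.\<close>
    obtain ps where ps: "mset ps = S" using ex_mset by blast
    then have len: "length ps = Q" using S by (metis size_mset)
    have psS: "ps ! i \<in># S" if "i < Q" for i using that ps len by auto
    have map_ps: "mset (map (\<lambda>i. h (ps ! i)) [0..<Q]) = image_mset h S" for h :: "_ \<Rightarrow> 'm"
    proof -
      have "map (\<lambda>i. h (ps ! i)) [0..<Q] = map h ps" using len by (auto intro: nth_equalityI)
      then show ?thesis using ps by simp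
    qed
    obtain U where U: "U \<in> sets borel" "mu_nbhd mu x U" "U \<subseteq> BB"
      using mu_nbhd_borel_subset[OF doubling BB] .
    have "g x \<in> AQ M Q" using C(2) xA A(2) by blast
    moreover have "cc \<in> germ_classes mu (AQ M Q) (AQ_dist d) x (g x)"
      unfolding cc_def germ_classes_def using repQ by blast
    moreover have "mset (map (\<lambda>i. f (ps ! i) x) [0..<Q]) = g x"
      using map_ps[of "\<lambda>p. f p x"] gf[OF xA] by simp
    moreover have "\<forall>i<Q. (x, f (ps ! i) x, c (ps ! i)) \<in> D" using c(1) psS by blast
    moreover have "\<forall>i<Q. \<forall>j<Q. f (ps ! i) x = f (ps ! j) x \<longrightarrow> c (ps ! i) = c (ps ! j)"
      using inj psS by (metis inj_onD)
    moreover have "\<forall>i<Q. (B (ps ! i), F (ps ! i)) \<in> c (ps ! i)" using c(2) psS by blast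
    moreover have "\<forall>i<Q. U \<subseteq> B (ps ! i)" using U(3) psS unfolding BB_def by blast
    moreover have "\<forall>y\<in>U. FF y = mset (map (\<lambda>i. F (ps ! i) y) [0..<Q])"
    proof
      fix y show "FF y = mset (map (\<lambda>i. F (ps ! i) y) [0..<Q])"
        using map_ps[of "\<lambda>p. F p y"] unfolding FF_def by (rule sym)
    qed
    ultimately have "\<exists>Ps cs. mset (map Ps [0..<Q]) = g x \<and> (\<forall>i<Q. (x, Ps i, cs i) \<in> D) \<and>
        (\<forall>i<Q. \<forall>j<Q. Ps i = Ps j \<longrightarrow> cs i = cs j) \<and>
        (\<exists>(B, FF) \<in> cc. \<exists>Bs Fs. (\<forall>i<Q. (Bs i, Fs i) \<in> cs i) \<and>
           (\<exists>U. U \<in> sets borel \<and> mu_nbhd mu x U \<and> U \<subseteq> B \<and> (\<forall>i<Q. U \<subseteq> Bs i) \<and>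
              (\<forall>y\<in>U. FF y = mset (map (\<lambda>i. Fs i y) [0..<Q]))))"
      using U cc
      by (intro exI[of _ "\<lambda>i. f (ps ! i) x"] exI[of _ "\<lambda>i. c (ps ! i)"] conjI bexI[of _ "(BB, FF)"] case_prodI
        exI[of _ "\<lambda>i. B (ps ! i)"] exI[of _ "\<lambda>i. F (ps ! i)"] exI[of _ U])
    then show ?thesis unfolding DQ_def using \<open>g x \<in> AQ M Q\<close> \<open>cc \<in> _\<close> by simp
  qed
  moreover have "mu_lim mu (C \<inter> BB) (\<lambda>y. AQ_dist d (g y) (FF y) / dist y x) x 0"
    unfolding mu_lim_def
  proof (intro allI impI)
    fix \<epsilon> :: real assume "0 < \<epsilon>"
    \<comment> \<open>The errors of the \<open>size S\<close> branches add up to at most half of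
      \<open>\<epsilon>\<close>, which keeps the final inequality strict.\<close>
    define \<eta> where "\<eta> = \<epsilon> / (2 * real (size S))"
    have \<eta>: "0 < \<eta>" "real (size S) * \<eta> < \<epsilon>" using \<open>0 < \<epsilon>\<close> Q unfolding \<eta>_def by simp_all
    have "\<forall>p\<in>#S. \<exists>U. mu_nbhd mu x U \<and> (\<forall>y \<in> U \<inter> (A \<inter> B p) - {x}. \<bar>d (f p y) (F p y) / dist y x - 0\<bar> < \<eta>)"
      using c(3) \<eta>(1) unfolding mu_lim_def by blast
    from bchoice[OF this] obtain U where U: "\<forall>p\<in>#S. mu_nbhd mu x (U p) \<and>
        (\<forall>y \<in> U p \<inter> (A \<inter> B p) - {x}. \<bar>d (f p y) (F p y) / dist y x - 0\<bar> < \<eta>)"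
      by (rule exE) (rule that)
    \<comment> \<open>Including \<open>A\<close> removes the points of \<open>C\<close> at which
      \<open>g\<close> has no description by branches.\<close>
    define V where "V = A \<inter> (\<Inter>p\<in>set_mset S. U p)"
    have "mu_nbhd mu x V"
      unfolding V_def using U A(1) by (intro mu_nbhd_Int[OF doubling] mu_nbhd_INT[OF doubling]) auto
    moreover have "\<bar>AQ_dist d (g y) (FF y) / dist y x - 0\<bar> < \<epsilon>" if y: "y \<in> V \<inter> (C \<inter> BB) - {x}" for y
    proof -
      have pos: "0 < dist y x" using y by simp
      have yA: "y \<in> A" using y unfolding V_def by blast
      have "d (f p y) (F p y) \<le> \<eta> * dist y x" if p: "p \<in># S" for p
      proof -
        have "y \<in> U p \<inter> (A \<inter> B p) - {x}" using y p unfolding V_def BB_def by blast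
        then have "\<bar>d (f p y) (F p y) / dist y x - 0\<bar> < \<eta>" using U p by blast
        then show ?thesis using pos by (simp add: field_simps abs_less_iff)
      qed
      then have "AQ_dist d (g y) (FF y) \<le> real (size S) * (\<eta> * dist y x)"
        unfolding FF_def gf[OF yA] by (rule AQ_dist_image_le_const[OF metric])
      also have "\<dots> < \<epsilon> * dist y x"
        using mult_strict_right_mono[OF \<eta>(2) pos] by (simp add: mult.assoc)
      finally have "AQ_dist d (g y) (FF y) / dist y x < \<epsilon>" using pos by (simp add: field_simps)
      moreover have "0 \<le> AQ_dist d (g y) (FF y)"
        unfolding FF_def gf[OF yA] by (intro AQ_dist_nonneg[OF metric]) simp
      ultimately show ?thesis by simp
    qed
    ultimately show "\<exists>U. mu_nbhd mu x U \<and>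
        (\<forall>y \<in> U \<inter> (C \<inter> BB) - {x}. \<bar>AQ_dist d (g y) (FF y) / dist y x - 0\<bar> < \<epsilon>)" by blast
  qed
  ultimately show ?thesis
    unfolding approx_diff_def using cc xA A(2) C(1) by (intro conjI exI[of _ cc] bexI[of _ "(BB, FF)"]) auto
qed

text \<open>On \<open>A\<close> the map splits into finitely many Lipschitz branches. Completeness
  of \<open>D\<close> applies to each of them on the closed set \<open>A\<close>, and the
  exceptional sets together with the non-density points of \<open>A\<close> remain null.\<close>

lemma AE_approx_diff_DQ_piece:
  fixes mu :: "'a::polish_space measure" and g :: "'a \<Rightarrow> 'm multiset"
  assumes doubling: "doubling_mms K mu" and metric: "Metric_space M d" and Q: "Q \<ge> 1"
    and D: "approx_distribution mu M d D" "diff_complete mu M d D"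
    and g: "g ` C \<subseteq> AQ M Q" and A: "closed A" "A \<subseteq> C"
    and lip: "\<And>y z. y \<in> A \<Longrightarrow> z \<in> A \<Longrightarrow> AQ_dist d (g y) (g z) \<le> L * dist y z"
    and sep: "\<And>y p q. y \<in> A \<Longrightarrow> p \<in># g y \<Longrightarrow> q \<in># g y \<Longrightarrow> p \<noteq> q \<Longrightarrow> \<delta> \<le> d p q"
    and close: "\<And>y z. y \<in> A \<Longrightarrow> z \<in> A \<Longrightarrow> AQ_dist d (g y) (g z) < \<delta> / 4"
    and B: "B \<in> sets (completion mu)" "B \<subseteq> {x. mu_acc mu C x}"
  shows "AE x in completion mu. x \<in> B \<inter> A \<longrightarrow> approx_diff mu (AQ_dist d) (DQ mu M d Q D) C g x"
proof (cases "A = {}")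
  case False
  note sets_mu [simp] = sets_mu[OF doubling]
  obtain x0 where x0: "x0 \<in> A" using False by blast
  have gA: "g ` A \<subseteq> AQ M Q" using g A(2) by blast
  obtain f where gf: "\<And>y. y \<in> A \<Longrightarrow> g y = image_mset (\<lambda>p. f p y) (g x0)"
    and inj: "\<And>y. y \<in> A \<Longrightarrow> inj_on (\<lambda>p. f p y) (set_mset (g x0))"
    and flip: "\<And>p y z. p \<in># g x0 \<Longrightarrow> y \<in> A \<Longrightarrow> z \<in> A \<Longrightarrow> d (f p y) (f p z) \<le> AQ_dist d (g y) (g z)"
    by (rule AQ_Lipschitz_selection[OF metric gA x0, of \<delta>]) (erule (3) sep, erule (1) close, rule that)
  have f_lip: "lipschitz_into M d A (f p)" if p: "p \<in># g x0" for p
  proof -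
    have "f p y \<in># g y" if "y \<in> A" for y using p gf[OF that] by simp
    then have "f p ` A \<subseteq> M" using gA unfolding AQ_def by blast
    then show ?thesis
      unfolding lipschitz_into_def using order_trans[OF flip[OF p] lip] by blast
  qed
  obtain N where N: "N \<in> null_sets mu" "\<And>x. x \<in> A \<Longrightarrow> x \<notin> N \<Longrightarrow>
      ((\<lambda>r. measure mu (ball x r - A) / measure mu (ball x r)) \<longlongrightarrow> 0) (at_right 0)"
    using AE_closed_density[OF doubling A(1)] by (auto elim!: AE_E3 simp: space_mu[OF doubling])
  \<comment> \<open>On \<open>B'\<close> the set \<open>A\<close> is a \<mu>-neighbourhood, so
    accumulation of \<open>C\<close> becomes accumulation of \<open>A\<close>, as completeness of
    \<open>D\<close> requires for maps defined on \<open>A\<close>.\<close>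
  define B' where "B' = B \<inter> A - N"
  have nbhd: "mu_nbhd mu x A" if "x \<in> B'" for x
    using N(2)[of x] that A(1) unfolding B'_def mu_nbhd_def by (intro conjI exI[of _ A]) auto
  have acc: "mu_acc mu A x" if "x \<in> B'" for x
    using mu_acc_Int_nbhd[OF doubling _ nbhd[OF that], of C] that B(2) A(2)
    unfolding B'_def by (auto simp: Int_absorb1)
  have sets_B': "B' \<in> sets (completion mu)"
    unfolding B'_def using B(1) A(1) N(1)
    by (intro sets.Diff sets.Int) auto
  have "AE x in completion mu. x \<in> B' \<longrightarrow> approx_diff mu d D A (f p) x" if p: "p \<in># g x0" for p
  proof -
    have "B' \<subseteq> acc_bounded_set mu d A (f p)"
      unfolding acc_bounded_set_def using acc nbhd
        lipschitz_mu_limsup_finite[OF mu_nbhd_UNIV[OF doubling] f_lip[OF p]] by (auto simp: B'_def)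
    then show ?thesis
      using D(2) A(1) False f_lip[OF p] sets_B' unfolding diff_complete_def by blast
  qed
  then have "AE x in completion mu. \<forall>p\<in>set_mset (g x0). x \<in> B' \<longrightarrow> approx_diff mu d D A (f p) x"
    by (intro AE_finite_allI) auto
  moreover have "AE x in completion mu. x \<notin> N" using N(1) by (intro AE_completion AE_not_in)
  ultimately show ?thesis
  proof eventually_elim
    case (elim x)
    show ?case
    proof
      assume x: "x \<in> B \<inter> A"
      then have x': "x \<in> B'" using elim unfolding B'_def by blast
      show "approx_diff mu (AQ_dist d) (DQ mu M d Q D) C g x"
      proof (rule approx_diff_DQ[OF doubling metric Q D(1) nbhd[OF x'] A(2)])
        show "size (g x0) = Q" using gA x0 unfolding AQ_def by auto
        show "inj_on (\<lambda>p. f p x) (set_mset (g x0))" using inj x by blast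
      qed (use B(2) x x' g gf elim in auto)
    qed
  qed
qed simp

section \<open>Covering the domain by countably many pieces\<close>

theorem theorem3p3:
  fixes K :: real and mu :: "'a::polish_space measure"
    and M :: "'m set" and d :: "'m \<Rightarrow> 'm \<Rightarrow> real" and Q :: nat
    and D :: "('a \<times> 'm \<times> ('a set \<times> ('a \<Rightarrow> 'm)) set) set"
  assumes "doubling_mms K mu"
    and "Metric_space M d" and "Metric_space.mcomplete M d"
    and "Q \<ge> 1"
    and "approx_distribution mu M d D"
    and "diff_complete mu M d D"
  shows "diff_complete mu (AQ M Q) (AQ_dist d) (DQ mu M d Q D)"
  unfolding diff_complete_def
proof (intro allI impI, elim conjE)
  fix C :: "'a set" and g :: "'a \<Rightarrow> 'm multiset" and B
  assume C: "closed C" and g: "lipschitz_into (AQ M Q) (AQ_dist d) C g"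
    and B: "B \<in> sets (completion mu)" "B \<subseteq> acc_bounded_set mu (AQ_dist d) C g"
  obtain L where L: "0 < L" "\<And>y z. y \<in> C \<Longrightarrow> z \<in> C \<Longrightarrow> AQ_dist d (g y) (g z) \<le> L * dist y z"
    by (rule lipschitz_intoE[OF g]) (rule that)
  have gC: "g ` C \<subseteq> AQ M Q" using g unfolding lipschitz_into_def by blast
  obtain X :: "'a set" where X: "countable X" "\<And>U. open U \<Longrightarrow> U \<noteq> {} \<Longrightarrow> \<exists>a\<in>X. a \<in> U"
    using countable_dense_setE by metis
  define \<delta> where "\<delta> n = 1 / real (Suc n)" for n
  \<comment> \<open>A ball of this radius has diameter at most \<open>2 * r n\<close>, so values of
    \<open>g\<close> on a piece differ by at most \<open>\<delta> n / 8\<close>, safely below the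
    \<open>\<delta> n / 4\<close> needed for the splitting.\<close>
  define r where "r n = \<delta> n / (16 * L)" for n
  have \<delta>: "0 < \<delta> n" for n unfolding \<delta>_def by simp
  then have r: "0 < r n" for n using L(1) unfolding r_def by simp
  define S where "S n = {y \<in> C. \<forall>p\<in>#g y. \<forall>q\<in>#g y. p \<noteq> q \<longrightarrow> \<delta> n \<le> d p q}" for n
  have "AE x in completion mu. x \<in> B \<inter> (S n \<inter> cball a (r n)) \<longrightarrow>
      approx_diff mu (AQ_dist d) (DQ mu M d Q D) C g x" for n a
  proof (rule AE_approx_diff_DQ_piece[OF assms(1,2,4,5,6) gC])
    show "closed (S n \<inter> cball a (r n))"
      unfolding S_def using closed_separated_points[OF assms(2) C gC L(2)] by (intro closed_Int) auto
    show "S n \<inter> cball a (r n) \<subseteq> C" unfolding S_def by blast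
    fix y z assume y: "y \<in> S n \<inter> cball a (r n)" and z: "z \<in> S n \<inter> cball a (r n)"
    then show le: "AQ_dist d (g y) (g z) \<le> L * dist y z" unfolding S_def by (intro L(2)) auto
    have "dist y z \<le> 2 * r n" using y z dist_triangle3[of y z a] by simp
    then have "L * dist y z \<le> L * (2 * r n)" using L(1) by simp
    also have "\<dots> = \<delta> n / 8" using L(1) unfolding r_def by simp
    also have "\<dots> < \<delta> n / 4" using \<delta>[of n] by simp
    finally show "AQ_dist d (g y) (g z) < \<delta> n / 4" using le by linarith
  next
    show "B \<in> sets (completion mu)" by (rule B)
    show "B \<subseteq> {x. mu_acc mu C x}" using B(2) unfolding acc_bounded_set_def by blast
  qed (auto simp: S_def)
  then have "AE x in completion mu. \<forall>n. \<forall>a\<in>X. x \<in> B \<inter> (S n \<inter> cball a (r n)) \<longrightarrow>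
      approx_diff mu (AQ_dist d) (DQ mu M d Q D) C g x"
    unfolding AE_all_countable AE_ball_countable[OF X(1)] by blast
  then show "AE x in completion mu. x \<in> B \<longrightarrow> approx_diff mu (AQ_dist d) (DQ mu M d Q D) C g x"
  proof eventually_elim
    case (elim x)
    show ?case
    proof
      assume x: "x \<in> B"
      then have xC: "x \<in> C" using B(2) unfolding acc_bounded_set_def by blast
      let ?P = "{(p, q). p \<in># g x \<and> q \<in># g x \<and> p \<noteq> q}"
      have fin: "finite ?P" by (rule finite_subset[of _ "set_mset (g x) \<times> set_mset (g x)"]) auto
      have "\<forall>(p, q)\<in>?P. 0 < d p q"
      proof clarify
        fix p q assume "p \<in># g x" "q \<in># g x" "p \<noteq> q"
        moreover have "set_mset (g x) \<subseteq> M" using gC xC unfolding AQ_def by blast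
        ultimately show "0 < d p q" using Metric_space.mdist_pos_less[OF assms(2)] by blast
      qed
      \<comment> \<open>Finitely many positive distances have a positive minimum, so
        \<open>x\<close> lies in some \<open>S n\<close>. The extra element 1 keeps the set nonempty
        when \<open>g x\<close> is a single point with multiplicity.\<close>
      then have "0 < Min (insert 1 ((\<lambda>(p, q). d p q) ` ?P))" using fin by (subst Min_gr_iff) auto
      then obtain n where "1 / real (Suc n) < Min (insert 1 ((\<lambda>(p, q). d p q) ` ?P))"
        by (rule nat_approx_posE) (rule that)
      then have n: "\<delta> n < Min (insert 1 ((\<lambda>(p, q). d p q) ` ?P))" unfolding \<delta>_def .
      have "\<delta> n \<le> d p q" if "p \<in># g x" "q \<in># g x" "p \<noteq> q" for p q
      proof -
        have "Min (insert 1 ((\<lambda>(p, q). d p q) ` ?P)) \<le> d p q" using fin that by (intro Min_le) auto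
        then show ?thesis using n by linarith
      qed
      then have "x \<in> S n" using xC unfolding S_def by blast
      \<comment> \<open>Density of \<open>X\<close> gives a centre within \<open>r n\<close> of
        \<open>x\<close>; by symmetry of the distance the piece around it contains
        \<open>x\<close>.\<close>
      moreover obtain a where a: "a \<in> X" "a \<in> ball x (r n)" using X(2)[of "ball x (r n)"] r[of n] by auto
      ultimately have "x \<in> B \<inter> (S n \<inter> cball a (r n))" using x by (simp add: dist_commute)
      then show "approx_diff mu (AQ_dist d) (DQ mu M d Q D) C g x" using elim a(1) by blast
    qed
  qed
qed

end
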